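(* Let $X,E$ be Euclidean spaces, $A:X\to\mathbf{R}^m$ and $B:X\to E$ linear maps, $\phi(\cdot)$ a norm on $\mathbf{R}^m$, and let a sparsity structure $(\|\cdot\|,\mathcal{P},\nu,P\mapsto\overline{P})$ on $E$ be given. Let $s\ge0$, $0\le\gamma<1$ and $0\le\beta<\infty$ be such that the condition $\mathbf{C}_s(\gamma,\beta;\phi)$ is satisfied, and let $\lambda>0$ satisfy $\lambda\ge\beta$. Let $x\in X$, $y\in\mathbf{R}^m$, $\xi=y-Ax$, and let $\delta_x,\delta\ge0$. Assume that there exists $P\in\mathcal{P}_s$ such that $\|(I-P)Bx\|\le\delta_x$ ($I$ being the identity on $E$), and let $\widehat{x}\in X$ satisfy $$\lambda\phi(A\widehat{x}-y)+\|B\widehat{x}\|\ \le\ \min_{z\in X}\left\{\lambda\phi(Az-y)+\|Bz\|\right\}+\delta.$$ Then $$\|B\widehat{x}-Bx\|\ \le\ \frac{2\delta_x+\delta+2\lambda\phi(\xi)}{1-\gamma}.$$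
   Context: Sparsity structure on a Euclidean space $E$: a norm $\|\cdot\|$ on $E$, with conjugate (dual) norm $\|\cdot\|_*$, together with a family $\mathcal{P}$ of linear maps of $E$ into itself such that: (A.1) every $P\in\mathcal{P}$ is a projector, $P^2=P$; (A.2) every $P\in\mathcal{P}$ is assigned a nonnegative weight $\nu(P)$ and a linear map $\overline{P}$ on $E$ such that $\overline{P}P=0$; (A.3) whenever $P\in\mathcal{P}$ and $f,g\in E$, one has $\|P^*f+\overline{P}^*g\|_*\le\max[\|f\|_*,\|g\|_*]$, where $Q^*$ denotes the conjugate (adjoint) of a linear map $Q$. For real $s\ge0$, $\mathcal{P}_s=\{P\in\mathcal{P}:\nu(P)\le s\}$. Condition $\mathbf{C}_s(\gamma,\beta;\phi)$: for all $z\in X$ and all $P\in\mathcal{P}_s$, $$\|PBz\|+\|Bz\|-\|\overline{P}Bz\|\le\beta\phi(Az)+\gamma\|Bz\|.$$ *)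

theory Defs
  imports "HOL-Analysis.Analysis"
begin

text \<open>
  The class operation \<^const>\<open>norm\<close> is the Euclidean norm; the norms below are arbitrary ones on
  the same space.
\<close>

locale is_norm =
  fixes N :: "'a::euclidean_space \<Rightarrow> real"
  assumes nonneg: "0 \<le> N x"
    and eq_zero_iff: "N x = 0 \<longleftrightarrow> x = 0"
    and scale: "N (c *\<^sub>R x) = \<bar>c\<bar> * N x"
    and triangle: "N (x + y) \<le> N x + N y"

definition dual_norm :: "('a::euclidean_space \<Rightarrow> real) \<Rightarrow> 'a \<Rightarrow> real"
  where "dual_norm N f = (SUP x \<in> {x. N x \<le> 1}. f \<bullet> x)"

text \<open>
  \<open>Ps\<close> is the family of projectors, \<open>\<nu>\<close> the weight and \<open>bar P\<close> the map assigned to \<open>P\<close>; the values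
  of \<open>\<nu>\<close> and \<open>bar\<close> outside \<open>Ps\<close> are irrelevant.
\<close>

locale sparsity_structure = is_norm N
  for N :: "'e::euclidean_space \<Rightarrow> real" +
  fixes Ps :: "('e \<Rightarrow> 'e) set"
    and \<nu> :: "('e \<Rightarrow> 'e) \<Rightarrow> real"
    and bar :: "('e \<Rightarrow> 'e) \<Rightarrow> 'e \<Rightarrow> 'e"
  assumes linear_proj: "P \<in> Ps \<Longrightarrow> linear P"
    and projector: "P \<in> Ps \<Longrightarrow> P \<circ> P = P"
    and weight_nonneg: "P \<in> Ps \<Longrightarrow> 0 \<le> \<nu> P"
    and linear_bar: "P \<in> Ps \<Longrightarrow> linear (bar P)"
    and bar_comp: "P \<in> Ps \<Longrightarrow> bar P \<circ> P = (\<lambda>_. 0)"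
    and dual_norm_le: "P \<in> Ps \<Longrightarrow>
      dual_norm N (adjoint P f + adjoint (bar P) g) \<le> max (dual_norm N f) (dual_norm N g)"

definition sparse_projectors ::
    "('e \<Rightarrow> 'e) set \<Rightarrow> (('e \<Rightarrow> 'e) \<Rightarrow> real) \<Rightarrow> real \<Rightarrow> ('e \<Rightarrow> 'e) set"
  where "sparse_projectors Ps \<nu> s = {P \<in> Ps. \<nu> P \<le> s}"

definition condition_C ::
    "('e::euclidean_space \<Rightarrow> real) \<Rightarrow> ('e \<Rightarrow> 'e) set \<Rightarrow> (('e \<Rightarrow> 'e) \<Rightarrow> real) \<Rightarrow> (('e \<Rightarrow> 'e) \<Rightarrow> 'e \<Rightarrow> 'e)
      \<Rightarrow> ('x::euclidean_space \<Rightarrow> real ^ 'm) \<Rightarrow> ('x \<Rightarrow> 'e)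
      \<Rightarrow> real \<Rightarrow> real \<Rightarrow> real \<Rightarrow> (real ^ 'm \<Rightarrow> real) \<Rightarrow> bool"
  where "condition_C N Ps \<nu> bar A B s \<gamma> \<beta> \<phi> \<longleftrightarrow>
    (\<forall>z. \<forall>P \<in> sparse_projectors Ps \<nu> s.
      N (P (B z)) + N (B z) - N (bar P (B z)) \<le> \<beta> * \<phi> (A z) + \<gamma> * N (B z))"

end

theory Submission
  imports Defs
begin

text \<open>
  Norming functionals turn the dual inequality (A.3) into the primal one
  \<open>N (P u) + N (bar P u) \<le> N u\<close>. Applied to \<open>u = P (B x) + d\<close> with \<open>d = B (xhat - x)\<close>, where
  \<open>bar P\<close> kills \<open>P (B x)\<close>, it bounds \<open>N (bar P d) - N (P d)\<close> by
  \<open>N (B xhat) - N (B x) + 2 * \<delta>\<^sub>x\<close>. Near-optimality of \<open>xhat\<close> and the condition \<open>C\<close> at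
  \<open>z = xhat - x\<close> then give the bound on \<open>N d\<close>.
\<close>

context is_norm
begin

lemma zero [simp]: "N 0 = 0"
  by (simp add: eq_zero_iff)

lemma pos: "x \<noteq> 0 \<Longrightarrow> 0 < N x"
  using nonneg[of x] eq_zero_iff[of x] by linarith

lemma minus [simp]: "N (- x) = N x"
  using scale[of "-1" x] by simp

lemma diff_triangle: "N x - N y \<le> N (x + y)"
  using triangle[of "x + y" "- y"] by simp

lemma convex: "convex_on UNIV N"
proof (rule convex_onI)
  fix t :: real and x y
  assume "0 < t" "t < 1"
  then show "N ((1 - t) *\<^sub>R x + t *\<^sub>R y) \<le> (1 - t) * N x + t * N y"
    using triangle[of "(1 - t) *\<^sub>R x" "t *\<^sub>R y"] by (simp add: scale)
qed simp

text \<open>A finite convex function on a finite-dimensional space is continuous.\<close>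

lemma continuous: "continuous_on S N"
  using convex_on_continuous[OF open_UNIV convex] continuous_on_subset by blast

text \<open>By compactness, \<open>N\<close> attains a positive minimum \<open>N m\<close> on the
  Euclidean unit sphere; homogeneity then gives the constant \<open>1 / N m\<close>.\<close>

lemma norm_bound: obtains C where "\<And>x. norm x \<le> C * N x"
proof -
  obtain b :: 'a where "b \<in> Basis"
    using nonempty_Basis by blast
  then have "sphere (0::'a) 1 \<noteq> {}"
    by (auto intro!: exI[of _ b])
  then obtain m where m: "m \<in> sphere 0 1" "\<And>x. x \<in> sphere 0 1 \<Longrightarrow> N m \<le> N x"
    using continuous_attains_inf[OF compact_sphere _ continuous] by metis
  then have "0 < N m"
    by (intro pos) auto
  have "norm x \<le> (1 / N m) * N x" for x
  proof (cases "x = 0")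
    case False
    then have "N m \<le> N ((1 / norm x) *\<^sub>R x)"
      by (intro m(2)) simp
    then show ?thesis
      using False \<open>0 < N m\<close> by (simp add: scale field_simps)
  qed simp
  then show ?thesis
    using that by blast
qed

text \<open>A real supremum dominates its members only when the set is bounded above;
  \<open>norm_bound\<close> with Cauchy-Schwarz supplies the bound.\<close>

lemma inner_le_dual_norm:
  assumes "N x \<le> 1"
  shows "f \<bullet> x \<le> dual_norm N f"
proof -
  obtain C where C: "\<And>x. norm x \<le> C * N x"
    using norm_bound by blast
  have "f \<bullet> z \<le> norm f * \<bar>C\<bar>" if "N z \<le> 1" for z
  proof -
    have "norm z \<le> \<bar>C\<bar> * N z"
      using C[of z] nonneg[of z] abs_ge_self mult_right_mono order_trans by metis
    also have "\<dots> \<le> \<bar>C\<bar>"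
      using that by (simp add: mult_left_le)
    finally have "norm f * norm z \<le> norm f * \<bar>C\<bar>"
      by (simp add: mult_left_mono)
    then show ?thesis
      using norm_cauchy_schwarz[of f z] by linarith
  qed
  then have "bdd_above ((\<bullet>) f ` {x. N x \<le> 1})"
    by (intro bdd_aboveI2) auto
  then show ?thesis
    unfolding dual_norm_def using assms by (intro cSUP_upper) auto
qed

lemma inner_le_dual_norm_mult: "f \<bullet> x \<le> dual_norm N f * N x"
proof (cases "x = 0")
  case False
  then have "0 < N x"
    by (rule pos)
  moreover from this have "f \<bullet> ((1 / N x) *\<^sub>R x) \<le> dual_norm N f"
    by (intro inner_le_dual_norm) (simp add: scale)
  ultimately show ?thesis
    by (simp add: field_simps)
qed simp

text \<open>Finite-dimensional Hahn-Banach: a hyperplane separates \<open>u\<close> from the open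
  \<open>N\<close>-ball of radius \<open>N u\<close>, and its normal, rescaled, is the
  functional.\<close>

lemma norming_functional:
  obtains f where "dual_norm N f \<le> 1" "f \<bullet> u = N u"
proof (cases "u = 0")
  \<comment> \<open>The open ball of radius \<open>N u\<close> is empty here, so the zero functional
    is taken instead.\<close>
  case True
  have "dual_norm N 0 \<le> 1"
    unfolding dual_norm_def by (rule cSUP_least) (auto intro!: exI[of _ 0])
  then show ?thesis
    using that[of 0] True by simp
next
  case False
  then have u: "0 < N u"
    by (rule pos)
  have "convex {v. N v < N u}"
  proof (rule convexI)
    fix v w and p q :: real
    assume "v \<in> {v. N v < N u}" "w \<in> {v. N v < N u}" "0 \<le> p" "0 \<le> q" "p + q = 1"
    then show "p *\<^sub>R v + q *\<^sub>R w \<in> {v. N v < N u}"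
      using triangle[of "p *\<^sub>R v" "q *\<^sub>R w"] convex_bound_lt[of "N v" "N u" "N w" p q]
      by (simp add: scale)
  qed
  moreover have "{v. N v < N u} \<noteq> {}"
    using u by (auto intro!: exI[of _ 0])
  ultimately obtain a b where ab: "a \<noteq> 0" "\<And>v. N v < N u \<Longrightarrow> a \<bullet> v \<le> b" "b \<le> a \<bullet> u"
    using separating_hyperplane_sets[of "{v. N v < N u}" "{u}"] by auto
  have "0 < N a"
    using ab(1) by (rule pos)
  \<comment> \<open>A multiple of \<open>a\<close> of \<open>N\<close>-norm \<open>N u / 2\<close>
    lies in the ball and has positive inner product with \<open>a\<close>; hence \<open>b\<close>,
    and with it \<open>a \<bullet> u\<close>, is positive.\<close>
  have "N ((N u / (2 * N a)) *\<^sub>R a) < N u"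
    using u \<open>0 < N a\<close> by (simp add: scale)
  then have "a \<bullet> ((N u / (2 * N a)) *\<^sub>R a) \<le> b"
    by (rule ab(2))
  moreover have "0 < a \<bullet> ((N u / (2 * N a)) *\<^sub>R a)"
    using u \<open>0 < N a\<close> ab(1) by simp
  ultimately have au: "0 < a \<bullet> u"
    using ab(3) by linarith
  define f where "f = (N u / (a \<bullet> u)) *\<^sub>R a"
  have f: "f \<bullet> v \<le> N u" if "N v < N u" for v
  proof -
    have "a \<bullet> v \<le> a \<bullet> u"
      using ab(2)[OF that] ab(3) by linarith
    then have "N u * (a \<bullet> v) \<le> N u * (a \<bullet> u)"
      using u by simp
    then show ?thesis
      using au by (simp add: f_def field_simps)
  qed
  have "f \<bullet> v \<le> N v" for v
  proof (rule ccontr)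
    assume "\<not> f \<bullet> v \<le> N v"
    \<comment> \<open>Scaling \<open>v\<close> by \<open>N u / m\<close> puts it strictly inside the
      ball while \<open>f\<close> exceeds \<open>N u\<close> there. Dividing by \<open>m\<close>
      rather than \<open>N v\<close> also covers \<open>v = 0\<close>.\<close>
    then obtain m where m: "N v < m" "m < f \<bullet> v"
      using dense[of "N v" "f \<bullet> v"] by auto
    then have "0 < m"
      using nonneg[of v] by linarith
    then have "N ((N u / m) *\<^sub>R v) < N u"
      using u m by (simp add: scale field_simps)
    then have "f \<bullet> ((N u / m) *\<^sub>R v) \<le> N u"
      by (rule f)
    then show False
      using u m \<open>0 < m\<close> by (simp add: field_simps)
  qed
  then have "dual_norm N f \<le> 1"
    unfolding dual_norm_def
    by (intro cSUP_least) (auto intro: order_trans exI[of _ 0])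
  moreover have "f \<bullet> u = N u"
    using au by (simp add: f_def)
  ultimately show ?thesis
    by (rule that)
qed

end

context sparsity_structure
begin

text \<open>With \<open>f\<close> and \<open>g\<close> norming \<open>P u\<close> and
  \<open>bar P u\<close>, the left side is the pairing of \<open>u\<close> with \<open>?h\<close>,
  whose dual norm is at most 1 by \<open>dual_norm_le\<close>.\<close>

lemma norm_split:
  assumes "P \<in> Ps"
  shows "N (P u) + N (bar P u) \<le> N u"
proof -
  obtain f where f: "dual_norm N f \<le> 1" "f \<bullet> P u = N (P u)"
    by (rule norming_functional)
  obtain g where g: "dual_norm N g \<le> 1" "g \<bullet> bar P u = N (bar P u)"
    by (rule norming_functional)
  let ?h = "adjoint P f + adjoint (bar P) g"
  have "dual_norm N ?h \<le> 1"
    using dual_norm_le[OF assms, of f g] f(1) g(1) by linarith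
  then have "?h \<bullet> u \<le> N u"
    using inner_le_dual_norm_mult[of ?h u] mult_right_mono[OF _ nonneg, of _ 1 u] by force
  moreover have "?h \<bullet> u = f \<bullet> P u + g \<bullet> bar P u"
    using assms by (simp add: inner_add_left adjoint_clauses linear_proj linear_bar)
  ultimately show ?thesis
    using f g by simp
qed

lemma sparse_perturbation:
  assumes "P \<in> Ps"
  shows "N (bar P d) - N (P d) \<le> N (w + d) - N w + 2 * N (w - P w)"
proof -
  have "P (P w + d) = P w + P d"
    using projector[OF assms] linear_add[OF linear_proj[OF assms]]
    by (metis comp_apply)
  moreover have "bar P (P w + d) = bar P d"
    using bar_comp[OF assms] linear_add[OF linear_bar[OF assms]]
    by (metis add_0 comp_apply)
  ultimately have "N (P w + P d) + N (bar P d) \<le> N (P w + d)"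
    using norm_split[OF assms, of "P w + d"] by simp
  \<comment> \<open>The defect \<open>N (w - P w)\<close> is paid twice, here and in the next bound,
    when \<open>P w\<close> is replaced by \<open>w\<close>; hence the factor 2.\<close>
  moreover have "N (P w + d) \<le> N (w + d) + N (w - P w)"
    using triangle[of "w + d" "- (w - P w)"] by (simp only: minus) (simp add: algebra_simps)
  moreover have "N w \<le> N (P w) + N (w - P w)"
    using triangle[of "P w" "w - P w"] by simp
  ultimately show ?thesis
    using diff_triangle[of "P w" "P d"] by linarith
qed

end

theorem proposition3p2:
  fixes A :: "'x::euclidean_space \<Rightarrow> real ^ 'm"
    and B :: "'x \<Rightarrow> 'e::euclidean_space"
    and \<phi> :: "real ^ 'm \<Rightarrow> real"
    and N :: "'e \<Rightarrow> real"
    and Ps :: "('e \<Rightarrow> 'e) set"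
    and \<nu> :: "('e \<Rightarrow> 'e) \<Rightarrow> real"
    and bar :: "('e \<Rightarrow> 'e) \<Rightarrow> 'e \<Rightarrow> 'e"
    and s \<gamma> \<beta> lam \<delta>\<^sub>x \<delta> :: real
    and x xhat :: 'x
    and y \<xi> :: "real ^ 'm"
  assumes "linear A" and "linear B"
    and "is_norm \<phi>"
    and "sparsity_structure N Ps \<nu> bar"
    and "0 \<le> s" and "0 \<le> \<gamma>" and "\<gamma> < 1" and "0 \<le> \<beta>"
    and "condition_C N Ps \<nu> bar A B s \<gamma> \<beta> \<phi>"
    and "0 < lam" and "\<beta> \<le> lam"
    and "\<xi> = y - A x"
    and "0 \<le> \<delta>\<^sub>x" and "0 \<le> \<delta>"
    and "\<exists>P \<in> sparse_projectors Ps \<nu> s. N (B x - P (B x)) \<le> \<delta>\<^sub>x"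
    and "lam * \<phi> (A xhat - y) + N (B xhat) \<le> (INF z. lam * \<phi> (A z - y) + N (B z)) + \<delta>"
  shows "N (B xhat - B x) \<le> (2 * \<delta>\<^sub>x + \<delta> + 2 * lam * \<phi> \<xi>) / (1 - \<gamma>)"
proof -
  interpret \<phi>: is_norm \<phi> by fact
  interpret sparsity_structure N Ps \<nu> bar by fact
  obtain P where P: "P \<in> sparse_projectors Ps \<nu> s" "N (B x - P (B x)) \<le> \<delta>\<^sub>x"
    using assms by blast
  then have "P \<in> Ps"
    by (simp add: sparse_projectors_def)
  let ?d = "B xhat - B x"
  have B: "B (xhat - x) = ?d" and A: "A (xhat - x) = (A xhat - y) + \<xi>"
    using assms by (simp_all add: linear_diff)
  \<comment> \<open>Boundedness below by 0 lets \<open>x\<close> compete in the infimum.\<close>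
  have "bdd_below (range (\<lambda>z. lam * \<phi> (A z - y) + N (B z)))"
    using \<open>0 < lam\<close> nonneg \<phi>.nonneg by (intro bdd_belowI2[of _ 0]) simp
  then have "(INF z. lam * \<phi> (A z - y) + N (B z)) \<le> lam * \<phi> (A x - y) + N (B x)"
    by (rule cINF_lower) simp
  moreover have "\<phi> (A x - y) = \<phi> \<xi>"
    using \<phi>.minus[of \<xi>] assms by simp
  ultimately have opt: "lam * \<phi> (A xhat - y) + N (B xhat) \<le> lam * \<phi> \<xi> + N (B x) + \<delta>"
    using assms by simp
  have "N (P ?d) + N ?d - N (bar P ?d) \<le> \<beta> * \<phi> (A (xhat - x)) + \<gamma> * N ?d"
    using assms P unfolding condition_C_def B[symmetric] by blast
  \<comment> \<open>Raising \<open>\<beta>\<close> to \<open>lam\<close> makes the residual term of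
    \<open>xhat\<close> cancel against the one in \<open>opt\<close>. Each of the two inequalities
    leaves one \<open>lam * \<phi> \<xi>\<close>.\<close>
  moreover have "\<beta> * \<phi> (A (xhat - x)) \<le> lam * (\<phi> (A xhat - y) + \<phi> \<xi>)"
    unfolding A using \<open>\<beta> \<le> lam\<close> \<open>0 < lam\<close> \<phi>.triangle \<phi>.nonneg by (intro mult_mono) auto
  moreover have "N (bar P ?d) - N (P ?d) \<le> N (B xhat) - N (B x) + 2 * \<delta>\<^sub>x"
    using sparse_perturbation[OF \<open>P \<in> Ps\<close>, of ?d "B x"] P(2) by simp
  ultimately have "(1 - \<gamma>) * N ?d \<le> 2 * \<delta>\<^sub>x + \<delta> + 2 * lam * \<phi> \<xi>"
    using opt by (simp add: algebra_simps)
  then show ?thesis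
    using \<open>\<gamma> < 1\<close> by (simp add: field_simps)
qed

end
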